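(* Let $0<s<1$, $2\le p<\infty$, $0<q<\infty$, $r\in\mathbb{R}$, and $\rho\in[0,1]$ with $r+1-\frac2p<\rho\le1$. Let $\sigma:\mathbb{T}\times\mathbb{Z}\to\mathbb{C}$ be a symbol such that for every integer $0\le\beta\le[1/p]+1$ there is a constant $C_\beta>0$ with $$|\partial_x^\beta\sigma(x,\xi)|\le C_\beta|\xi|^{-\rho},\qquad x\in\mathbb{T},\ \xi\in\mathbb{Z},\ \xi\neq0.$$ Then $\mathrm{Op}(\sigma)$ is a bounded operator from $B^{s}_{\infty,\infty}(\mathbb{T})$ into $B^{r}_{p,q}(\mathbb{T})$.
   Context: $\mathbb{T}=[0,2\pi)$ is the one-dimensional torus with normalized Haar measure $dx$; $\widehat f(\xi)=\int_{\mathbb{T}}e^{-ix\xi}f(x)\,dx$ for $\xi\in\mathbb{Z}$, so that $f(x)=\sum_{\xi\in\mathbb{Z}}e^{ix\xi}\widehat f(\xi)$ for $f\in C^\infty(\mathbb{T})$. For a symbol $\sigma:\mathbb{T}\times\mathbb{Z}\to\mathbb{C}$, the periodic pseudo-differential operator is $\mathrm{Op}(\sigma)f(x)=\sum_{\xi\in\mathbb{Z}}e^{ix\xi}\sigma(x,\xi)\widehat f(\xi)$. $[t]$ denotes the integer part of $t$. Besov spaces: for $r\in\mathbb{R}$, $0<p\le\infty$, $0<q<\infty$, $$\|f\|_{B^r_{p,q}}=\Big(\sum_{m=0}^\infty 2^{mrq}\Big\|\sum_{2^m\le|\xi|<2^{m+1}}e^{ix\xi}\widehat f(\xi)\Big\|_{L^p(\mathbb{T})}^q\Big)^{1/q},$$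 $$\|f\|_{B^r_{p,\infty}}=\sup_{m\ge 0}2^{mr}\Big\|\sum_{2^m\le|\xi|<2^{m+1}}e^{ix\xi}\widehat f(\xi)\Big\|_{L^p(\mathbb{T})}.$$ For $0<r<1$ the paper identifies $B^r_{\infty,\infty}(\mathbb{T})$ with the Hölder space $\Lambda^r(\mathbb{T})$ with norm $\|f\|_{\Lambda^r}=\sup_{x,\,y\neq 0}\frac{|f(x-y)-f(x)|}{|y|^r}+\sup_x|f(x)|$. Bounded from $X$ into $Y$ means: there is $C>0$ with $\|\mathrm{Op}(\sigma)f\|_Y\le C\|f\|_X$ for all $f\in C^\infty(\mathbb{T})$. *)

theory Defs
  imports "HOL-Analysis.Analysis"
begin

text \<open>Functions on the torus are rendered as \<open>2\<pi>\<close>-periodic functions on the real line;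
  they are integrated over \<open>[0, 2\<pi>)\<close> against normalized Lebesgue measure.\<close>

definition torus_measure :: "real measure" where
  "torus_measure = uniform_measure lborel {0..<2 * pi}"

definition x_deriv :: "(real \<Rightarrow> complex) \<Rightarrow> real \<Rightarrow> complex" where
  "x_deriv g = (\<lambda>x. vector_derivative g (at x))"

definition Ck_torus :: "nat \<Rightarrow> (real \<Rightarrow> complex) set" where
  "Ck_torus k = {g. (\<forall>x. g (x + 2 * pi) = g x) \<and>
     (\<forall>j<k. (x_deriv ^^ j) g differentiable_on UNIV) \<and>
     continuous_on UNIV ((x_deriv ^^ k) g)}"

definition Cinf_torus :: "(real \<Rightarrow> complex) set" where
  "Cinf_torus = (\<Inter>k. Ck_torus k)"

definition fourier_coeff :: "(real \<Rightarrow> complex) \<Rightarrow> int \<Rightarrow> complex" where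
  "fourier_coeff f \<xi> = (\<integral>x. cis (- (x * real_of_int \<xi>)) * f x \<partial>torus_measure)"

text \<open>The unconditional sum is the intended one whenever \<open>f\<close> is smooth and \<open>\<sigma>\<close> is bounded, since
  the Fourier coefficients of \<open>f\<close> then decay rapidly; if in addition each \<open>\<sigma> (\<cdot>, \<xi>)\<close> is
  continuous, then so is \<open>Op \<sigma> f\<close>, and its Fourier coefficients are genuine integrals.\<close>

definition Op :: "(real \<Rightarrow> int \<Rightarrow> complex) \<Rightarrow> (real \<Rightarrow> complex) \<Rightarrow> real \<Rightarrow> complex" where
  "Op \<sigma> f x = (\<Sum>\<^sub>\<infinity>\<xi>\<in>UNIV. cis (x * real_of_int \<xi>) * \<sigma> x \<xi> * fourier_coeff f \<xi>)"

definition ennreal_powr :: "ennreal \<Rightarrow> real \<Rightarrow> ennreal" where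
  \<comment> \<open>intended for positive exponents only, where \<open>0\<close> is sent to \<open>0\<close> and \<open>\<infinity>\<close> to \<open>\<infinity>\<close>\<close>
  "ennreal_powr t a = (if t = \<infinity> then \<infinity> else ennreal (enn2real t powr a))"

definition Lp_norm :: "real \<Rightarrow> (real \<Rightarrow> complex) \<Rightarrow> ennreal" where
  "Lp_norm p g = ennreal_powr (\<integral>\<^sup>+x. ennreal (cmod (g x) powr p) \<partial>torus_measure) (1 / p)"

definition dyadic_block :: "nat \<Rightarrow> (real \<Rightarrow> complex) \<Rightarrow> real \<Rightarrow> complex" where
  "dyadic_block m f x =
     (\<Sum>\<xi>\<in>{\<xi>::int. 2 ^ m \<le> \<bar>\<xi>\<bar> \<and> \<bar>\<xi>\<bar> < 2 ^ (m + 1)}.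
        cis (x * real_of_int \<xi>) * fourier_coeff f \<xi>)"

text \<open>The Besov (quasi-)norm for finite exponents \<open>p\<close> and \<open>q\<close>. No dyadic block contains the
  frequency \<open>\<xi> = 0\<close>, so constants have norm \<open>0\<close>.\<close>

definition besov_norm :: "real \<Rightarrow> real \<Rightarrow> real \<Rightarrow> (real \<Rightarrow> complex) \<Rightarrow> ennreal" where
  "besov_norm r p q f =
     ennreal_powr
       (\<Sum>m. ennreal (2 powr (real m * r * q)) * ennreal_powr (Lp_norm p (dyadic_block m f)) q)
       (1 / q)"

text \<open>For \<open>0 < r < 1\<close> the Besov space \<open>B\<^sup>r\<close> with both exponents infinite is identified with the
  Hoelder space \<open>\<Lambda>\<^sup>r\<close> and carries the norm of the latter. This norm, unlike one made of dyadic
  blocks alone, does not vanish on constants, whose images under \<open>Op \<sigma>\<close> are the multiples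
  of \<open>\<sigma> (\<cdot>, 0)\<close>.\<close>

definition holder_norm :: "real \<Rightarrow> (real \<Rightarrow> complex) \<Rightarrow> ennreal" where
  "holder_norm r f =
     (SUP x. SUP y\<in>-{0}. ennreal (cmod (f (x - y) - f x) / \<bar>y\<bar> powr r)) + (SUP x. ennreal (cmod (f x)))"

definition bounded_into ::
  "((real \<Rightarrow> complex) \<Rightarrow> real \<Rightarrow> complex) \<Rightarrow> ((real \<Rightarrow> complex) \<Rightarrow> ennreal) \<Rightarrow>
   ((real \<Rightarrow> complex) \<Rightarrow> ennreal) \<Rightarrow> bool" where
  "bounded_into T normX normY \<longleftrightarrow>
     (\<exists>C>0::real. \<forall>f\<in>Cinf_torus. normY (T f) \<le> ennreal C * normX f)"

end

theory Submission
  imports Defs "HOL-Probability.Probability_Measure"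
begin

text \<open>
  As \<open>p \<ge> 2\<close>, the integer part of \<open>1 / p\<close> is \<open>0\<close>, and the symbol has one controlled derivative in \<open>x\<close>.
  Everything is reduced to \<open>L\<^sup>2\<close>. Write \<open>N = 2 ^ m\<close> for the size of the frequencies in the block of level \<open>m\<close>.
  The heart of the matter is that the Fourier coefficients of \<open>Op \<sigma> f\<close> at frequencies of modulus at
  least \<open>N\<close> have square sum at most a constant times \<open>(N powr (- \<rho>) * H)\<^sup>2\<close>, where \<open>H\<close> is the
  Hoelder norm of \<open>f\<close> and enters as a bound for \<open>\<bar>f\<bar>\<close> (\<open>partial_Op_coeff_bound\<close>, \<open>Op_coeff_bound\<close>).

  Its proof splits \<open>f\<close> at the frequency \<open>N\<close>. The part with frequencies \<open>\<bar>\<xi>\<bar> \<ge> N\<close> meets a symbol of size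
  \<open>N powr (- \<rho>)\<close>, and a single \<open>x\<close>-derivative of that size suffices for boundedness on \<open>L\<^sup>2\<close>
  (\<open>variable_coefficient_L2_bound\<close>), whatever the dependence on \<open>\<xi>\<close>. The image of the part with
  \<open>\<bar>\<xi>\<bar> < N\<close> is differentiated once. Its derivative is \<open>Op (\<i>\<xi> \<sigma>)\<close> plus \<open>Op (\<partial>\<^sub>x \<sigma>)\<close> applied to this
  part, and has \<open>L\<^sup>2\<close> norm at most a constant times \<open>N powr (1 - \<rho>) * H\<close>: for the first summand by the same
  \<open>L\<^sup>2\<close> bound, for the second by the Cauchy--Schwarz inequality, as
  \<open>\<bar>\<xi>\<bar> powr (- \<rho>) \<le> N powr (1 - \<rho>) / \<bar>\<xi>\<bar>\<close> (\<open>low_frequency_derivative_bound\<close>). At frequencies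
  \<open>\<bar>\<eta>\<bar> \<ge> N\<close> the derivative is worth a factor \<open>N\<close>, and \<open>N powr (- \<rho>)\<close> results.

  Bernstein's inequality (\<open>Lp_norm_trig_poly_le\<close>) takes a block from \<open>L\<^sup>2\<close> to \<open>L\<^sup>p\<close> at the price of
  \<open>N powr (1/2 - 1/p)\<close>. Hence the terms of the Besov sum decay geometrically as soon as
  \<open>r + 1/2 - 1/p < \<rho>\<close>. Since \<open>1/2 - 1/p\<close> is nonnegative, it is at most \<open>1 - 2/p\<close>, so this follows from
  \<open>r + 1 - 2/p < \<rho>\<close>.
\<close>

section \<open>Integration over the torus\<close>

lemma sets_torus_measure [simp, measurable_cong]: "sets torus_measure = sets borel"
  by (simp add: torus_measure_def)

lemma prob_space_torus_measure: "prob_space torus_measure"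
  unfolding torus_measure_def by (rule prob_space_uniform_measure) auto

interpretation torus: prob_space torus_measure
  by (rule prob_space_torus_measure)

lemma AE_torus_measure: "AE x in torus_measure. 0 \<le> x \<and> x \<le> 2 * pi"
  unfolding torus_measure_def by (rule AE_uniform_measureI) auto

lemma measurable_torus_measure:
  fixes f :: "real \<Rightarrow> 'a::{banach, second_countable_topology}"
  assumes "continuous_on UNIV f"
  shows "f \<in> borel_measurable torus_measure"
  using borel_measurable_continuous_onI[OF assms]
  by (simp cong: measurable_cong_sets)

lemma integrable_torus_measure:
  fixes f :: "real \<Rightarrow> 'a::{banach, second_countable_topology}"
  assumes "continuous_on UNIV f"
  shows "integrable torus_measure f"
proof -
  have "bounded (f ` {0..2 * pi})"
    by (intro compact_imp_bounded compact_continuous_image continuous_on_subset[OF assms]) auto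
  then obtain B where B: "\<And>x. x \<in> {0..2 * pi} \<Longrightarrow> norm (f x) \<le> B"
    unfolding bounded_iff by blast
  have "AE x in torus_measure. norm (f x) \<le> B"
    using AE_torus_measure by eventually_elim (use B in auto)
  then show ?thesis
    by (rule torus.integrable_const_bound) (rule measurable_torus_measure[OF assms])
qed

lemma integral_torus_measure:
  fixes f :: "real \<Rightarrow> 'a::euclidean_space"
  assumes "continuous_on UNIV f"
  shows "(\<integral>x. f x \<partial>torus_measure) = (1 / (2 * pi)) *\<^sub>R integral {0..2 * pi} f"
proof -
  have M: "torus_measure = density lborel (\<lambda>x. ennreal (indicator {0..<2 * pi} x / (2 * pi)))"
    unfolding torus_measure_def uniform_measure_def
    by (rule arg_cong2[where f = density])
      (auto simp: fun_eq_iff divide_ennreal ennreal_1[symmetric] split: split_indicator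
        simp del: ennreal_1)
  have int: "set_integrable lborel {0..2 * pi} f"
    by (rule borel_integrable_atLeastAtMost') (rule continuous_on_subset[OF assms], simp)
  have "(\<integral>x. f x \<partial>torus_measure)
      = (\<integral>x. (indicator {0..<2 * pi} x / (2 * pi)) *\<^sub>R f x \<partial>lborel)"
    unfolding M
    by (rule integral_density) (use borel_measurable_continuous_onI[OF assms] in auto)
  \<comment> \<open>The half-open and the closed interval differ by a null set.\<close>
  also have "\<dots> = (\<integral>x. (1 / (2 * pi)) *\<^sub>R (indicator {0..2 * pi} x *\<^sub>R f x) \<partial>lborel)"
  proof (rule integral_cong_AE)
    have "AE x in lborel. x \<noteq> 2 * pi"
      by (rule AE_lborel_singleton)
    then show "AE x in lborel. (indicator {0..<2 * pi} x / (2 * pi)) *\<^sub>R f x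
        = (1 / (2 * pi)) *\<^sub>R (indicator {0..2 * pi} x *\<^sub>R f x)"
      by eventually_elim (auto split: split_indicator)
  qed (use borel_measurable_continuous_onI[OF assms] in auto)
  also have "\<dots> = (1 / (2 * pi)) *\<^sub>R integral {0..2 * pi} f"
    using set_borel_integral_eq_integral(2)[OF int]
    by (simp only: integral_scaleR_right set_lebesgue_integral_def)
  finally show ?thesis .
qed

lemma integral_torus_derivative:
  fixes F :: "real \<Rightarrow> 'a::euclidean_space"
  assumes deriv: "\<And>x. (F has_vector_derivative F' x) (at x)"
    and cont: "continuous_on UNIV F'"
  shows "(\<integral>x. F' x \<partial>torus_measure) = (1 / (2 * pi)) *\<^sub>R (F (2 * pi) - F 0)"
proof -
  have "(F' has_integral (F (2 * pi) - F 0)) {0..2 * pi}"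
    by (rule fundamental_theorem_of_calculus)
      (auto intro: has_vector_derivative_at_within deriv)
  then show ?thesis
    by (simp add: integral_torus_measure[OF cont] integral_unique)
qed

text \<open>A one-dimensional Sobolev embedding: a single derivative controls the supremum by an integral,
  which can then be exchanged with other integrals.\<close>

lemma norm_le_start_plus_variation:
  fixes F :: "real \<Rightarrow> 'a::euclidean_space"
  assumes deriv: "\<And>x. (F has_vector_derivative F' x) (at x)"
    and cont: "continuous_on UNIV F'"
    and x: "0 \<le> x" "x \<le> 2 * pi"
  shows "norm (F x) \<le> norm (F 0) + 2 * pi * (\<integral>t. norm (F' t) \<partial>torus_measure)"
proof -
  have contn: "continuous_on UNIV (\<lambda>t. norm (F' t))"
    by (intro continuous_intros cont)
  have I: "(F' has_integral (F x - F 0)) {0..x}"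
    by (rule fundamental_theorem_of_calculus)
      (use x in \<open>auto intro: has_vector_derivative_at_within deriv\<close>)
  have int: "(\<lambda>t. norm (F' t)) integrable_on {0..b}" for b
    by (rule integrable_continuous_real) (rule continuous_on_subset[OF contn], simp)
  have "norm (F x - F 0) \<le> integral {0..x} (\<lambda>t. norm (F' t))"
    using integral_norm_bound_integral[OF has_integral_integrable[OF I] int]
    by (simp add: integral_unique[OF I])
  also have "\<dots> \<le> integral {0..2 * pi} (\<lambda>t. norm (F' t))"
    by (rule integral_subset_le) (use x int in auto)
  also have "\<dots> = 2 * pi * (\<integral>t. norm (F' t) \<partial>torus_measure)"
    by (simp add: integral_torus_measure[OF contn])
  finally show ?thesis
    using norm_triangle_ineq2[of "F x" "F 0"] by simp
qed

text \<open>The difference of the two sides is the variance of \<open>f\<close>, as the torus has total mass one.\<close>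

lemma square_integral_le_integral_square:
  fixes f :: "real \<Rightarrow> real"
  assumes "continuous_on UNIV f"
  shows "(\<integral>x. f x \<partial>torus_measure)\<^sup>2 \<le> (\<integral>x. (f x)\<^sup>2 \<partial>torus_measure)"
proof -
  have "0 \<le> torus.variance f"
    by (rule torus.variance_positive)
  also have "\<dots> = (\<integral>x. (f x)\<^sup>2 \<partial>torus_measure) - (\<integral>x. f x \<partial>torus_measure)\<^sup>2"
    by (intro torus.variance_eq integrable_torus_measure continuous_intros assms)
  finally show ?thesis by simp
qed

section \<open>Fourier coefficients of continuous functions\<close>

lemma has_vector_derivative_cis:
  "((\<lambda>x. cis (x * k)) has_vector_derivative \<i> * of_real k * cis (x * k)) (at x)"
  unfolding has_vector_derivative_def
  by (rule has_derivative_eq_rhs, rule has_derivative_cis)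
    (auto intro!: derivative_eq_intros simp: fun_eq_iff scaleR_conv_of_real)

lemma cis_2pi_int: "cis (2 * pi * of_int k) = 1"
  by (simp add: cis_conv_exp exp_eq_1 mult.commute)

definition trig_poly :: "int set \<Rightarrow> (int \<Rightarrow> complex) \<Rightarrow> real \<Rightarrow> complex" where
  "trig_poly F a x = (\<Sum>\<xi>\<in>F. cis (x * of_int \<xi>) * a \<xi>)"

lemma continuous_on_trig_poly: "continuous_on A (trig_poly F a)"
  unfolding trig_poly_def by (intro continuous_intros)

text \<open>For distinct frequencies the integrand is the derivative of a function with period \<open>2\<pi>\<close>.\<close>

lemma fourier_coeff_cis: "fourier_coeff (\<lambda>x. cis (x * of_int \<xi>)) \<eta> = (if \<xi> = \<eta> then 1 else 0)"
proof -
  define k where "k = real_of_int (\<xi> - \<eta>)"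
  have eq: "cis (- (x * of_int \<eta>)) * cis (x * of_int \<xi>) = cis (x * k)" for x
    by (simp add: cis_mult k_def algebra_simps)
  show ?thesis
  proof (cases "\<xi> = \<eta>")
    case True
    then show ?thesis
      unfolding fourier_coeff_def eq by (simp add: k_def torus.prob_space)
  next
    case False
    then have "k \<noteq> 0" by (simp add: k_def)
    have D: "((\<lambda>x. cis (x * k) / (\<i> * of_real k)) has_vector_derivative cis (x * k)) (at x)" for x
      using has_vector_derivative_divide[OF has_vector_derivative_cis[of k x], of "\<i> * of_real k"]
        \<open>k \<noteq> 0\<close> by simp
    have "cis (2 * pi * k) = 1"
      unfolding k_def by (rule cis_2pi_int)
    with integral_torus_derivative[OF D] False show ?thesis
      by (simp add: fourier_coeff_def eq continuous_intros)
  qed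
qed

lemma integral_mult_cnj_trig_poly:
  assumes "finite F" "continuous_on UNIV f"
  shows "(\<integral>x. f x * cnj (trig_poly F a x) \<partial>torus_measure)
    = (\<Sum>\<xi>\<in>F. fourier_coeff f \<xi> * cnj (a \<xi>))"
proof -
  have "(\<integral>x. f x * cnj (trig_poly F a x) \<partial>torus_measure)
      = (\<integral>x. (\<Sum>\<xi>\<in>F. (cis (- (x * of_int \<xi>)) * f x) * cnj (a \<xi>)) \<partial>torus_measure)"
    by (intro Bochner_Integration.integral_cong)
      (auto simp: trig_poly_def sum_distrib_left cis_cnj mult_ac)
  also have "\<dots> = (\<Sum>\<xi>\<in>F. (\<integral>x. (cis (- (x * of_int \<xi>)) * f x) * cnj (a \<xi>) \<partial>torus_measure))"
    by (intro Bochner_Integration.integral_sum integrable_torus_measure continuous_intros assms)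
  also have "\<dots> = (\<Sum>\<xi>\<in>F. fourier_coeff f \<xi> * cnj (a \<xi>))"
    by (simp add: fourier_coeff_def)
  finally show ?thesis .
qed

lemma fourier_coeff_trig_poly:
  assumes "finite F"
  shows "fourier_coeff (trig_poly F a) \<eta> = (if \<eta> \<in> F then a \<eta> else 0)"
proof -
  have "fourier_coeff (trig_poly F a) \<eta>
      = (\<integral>x. (\<Sum>\<xi>\<in>F. (cis (- (x * of_int \<eta>)) * cis (x * of_int \<xi>)) * a \<xi>) \<partial>torus_measure)"
    by (simp add: fourier_coeff_def trig_poly_def sum_distrib_left mult_ac)
  also have "\<dots> = (\<Sum>\<xi>\<in>F. (\<integral>x. (cis (- (x * of_int \<eta>)) * cis (x * of_int \<xi>)) * a \<xi> \<partial>torus_measure))"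
    by (intro Bochner_Integration.integral_sum integrable_torus_measure continuous_intros)
  also have "\<dots> = (\<Sum>\<xi>\<in>F. fourier_coeff (\<lambda>x. cis (x * of_int \<xi>)) \<eta> * a \<xi>)"
    by (simp add: fourier_coeff_def)
  also have "\<dots> = (if \<eta> \<in> F then a \<eta> else 0)"
    using assms by (simp add: fourier_coeff_cis if_distrib[of "\<lambda>z. z * _"] sum.delta cong: if_cong)
  finally show ?thesis .
qed

lemma parseval_trig_poly:
  assumes "finite F"
  shows "(\<integral>x. (cmod (trig_poly F a x))\<^sup>2 \<partial>torus_measure) = (\<Sum>\<xi>\<in>F. (cmod (a \<xi>))\<^sup>2)"
proof -
  have "complex_of_real (\<integral>x. (cmod (trig_poly F a x))\<^sup>2 \<partial>torus_measure)
      = (\<integral>x. trig_poly F a x * cnj (trig_poly F a x) \<partial>torus_measure)"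
    by (simp only: complex_norm_square flip: integral_complex_of_real)
  also have "\<dots> = (\<Sum>\<xi>\<in>F. complex_of_real ((cmod (a \<xi>))\<^sup>2))"
    by (simp add: integral_mult_cnj_trig_poly[OF assms continuous_on_trig_poly]
        fourier_coeff_trig_poly[OF assms] complex_norm_square del: of_real_power)
  finally show ?thesis
    by (metis of_real_eq_iff of_real_sum)
qed

text \<open>The partial Fourier sum \<open>P\<close> over \<open>F\<close> satisfies \<open>\<langle>f, P\<rangle> = \<langle>P, P\<rangle>\<close>, so the right-hand side exceeds the left
  by the squared norm of \<open>f - P\<close>.\<close>

lemma bessel_inequality:
  assumes F: "finite F" and f: "continuous_on UNIV f"
  shows "(\<Sum>\<xi>\<in>F. (cmod (fourier_coeff f \<xi>))\<^sup>2) \<le> (\<integral>x. (cmod (f x))\<^sup>2 \<partial>torus_measure)"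
proof -
  define P where "P = trig_poly F (fourier_coeff f)"
  define S where "S = (\<Sum>\<xi>\<in>F. (cmod (fourier_coeff f \<xi>))\<^sup>2)"
  have P: "continuous_on UNIV P"
    unfolding P_def by (rule continuous_on_trig_poly)
  have ip: "(\<integral>x. f x * cnj (P x) \<partial>torus_measure) = of_real S"
    unfolding P_def S_def integral_mult_cnj_trig_poly[OF F f]
    by (simp add: complex_norm_square flip: of_real_power)
  define R where "R = (\<lambda>x. Re (f x * cnj (P x)))"
  have "integrable torus_measure (\<lambda>x. f x * cnj (P x))"
    by (intro integrable_torus_measure continuous_intros f P)
  then have R: "(\<integral>x. R x \<partial>torus_measure) = S"
    unfolding R_def by (subst integral_Re) (simp_all only: ip Re_complex_of_real)
  have int: "integrable torus_measure (\<lambda>x. (cmod (f x))\<^sup>2)" "integrable torus_measure R"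
    "integrable torus_measure (\<lambda>x. (cmod (P x))\<^sup>2)"
    unfolding R_def by (intro integrable_torus_measure continuous_intros f P)+
  have "0 \<le> (\<integral>x. (cmod (f x - P x))\<^sup>2 \<partial>torus_measure)"
    by (rule Bochner_Integration.integral_nonneg) simp
  also have "\<dots> = (\<integral>x. (cmod (f x))\<^sup>2 - 2 * R x + (cmod (P x))\<^sup>2 \<partial>torus_measure)"
    unfolding R_def by (intro Bochner_Integration.integral_cong refl)
      (simp add: cmod_power2, simp add: power2_eq_square algebra_simps)
  also have "\<dots> = (\<integral>x. (cmod (f x))\<^sup>2 \<partial>torus_measure) - 2 * S + S"
    using int parseval_trig_poly[OF F, of "fourier_coeff f"]
    by (simp add: R P_def S_def)
  finally show ?thesis
    by (simp add: S_def)
qed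

lemma fourier_coeff_derivative:
  assumes deriv: "\<And>x. (g has_vector_derivative g' x) (at x)"
    and cont: "continuous_on UNIV g'" and per: "g (2 * pi) = g 0"
  shows "fourier_coeff g' \<xi> = \<i> * of_int \<xi> * fourier_coeff g \<xi>"
proof -
  have g: "continuous_on UNIV g"
    using deriv by (meson continuous_at_imp_continuous_on has_vector_derivative_continuous)
  have D: "((\<lambda>x. cis (x * (- of_int \<xi>)) * g x) has_vector_derivative
      cis (x * (- of_int \<xi>)) * g' x + \<i> * of_real (- of_int \<xi>) * cis (x * (- of_int \<xi>)) * g x) (at x)" for x
    by (rule has_vector_derivative_mult[OF has_vector_derivative_cis deriv])
  have "cis (2 * pi * (- of_int \<xi>)) = 1"
    using cis_2pi_int[of "- \<xi>"] by simp
  then have "0 = (\<integral>x. cis (x * (- of_int \<xi>)) * g' x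
      + \<i> * of_real (- of_int \<xi>) * cis (x * (- of_int \<xi>)) * g x \<partial>torus_measure)"
    by (subst integral_torus_derivative[OF D]) (auto intro!: continuous_intros cont g simp: per)
  also have "\<dots> = (\<integral>x. cis (- (x * of_int \<xi>)) * g' x
      + (- \<i> * of_int \<xi>) * (cis (- (x * of_int \<xi>)) * g x) \<partial>torus_measure)"
    by (simp add: algebra_simps)
  also have "\<dots> = fourier_coeff g' \<xi> + (- \<i> * of_int \<xi>) * fourier_coeff g \<xi>"
    unfolding fourier_coeff_def
    by (subst Bochner_Integration.integral_add) (auto intro!: integrable_torus_measure continuous_intros cont g)
  finally show ?thesis by simp
qed

section \<open>An \<open>L\<^sup>2\<close> bound for variable coefficients\<close>

lemma power2_add_le: "(x + y)\<^sup>2 \<le> 2 * x\<^sup>2 + 2 * y\<^sup>2" for x y :: real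
  using sum_squares_bound[of x y] by (simp add: power2_sum)

text \<open>Parseval's identity does not apply when the coefficients depend on \<open>x\<close>. Freezing them at a parameter
  \<open>t\<close> repairs this: at a point \<open>x\<close>, the fundamental theorem of calculus in the frozen variable bounds the
  sum by its value with coefficients frozen at \<open>0\<close> plus the integral over \<open>t\<close> of the trigonometric
  polynomials with coefficients \<open>b' t \<xi> * c \<xi>\<close>. After squaring, Tonelli's theorem lets the integral over
  \<open>x\<close> come first, and Parseval's identity then applies for each \<open>t\<close>. The constant is
  \<open>2 + 2 (2\<pi>)\<^sup>2 \<le> 130\<close>, from \<open>\<pi> < 4\<close>.\<close>

lemma variable_coefficient_L2_bound:
  fixes b b' :: "real \<Rightarrow> int \<Rightarrow> complex" and c :: "int \<Rightarrow> complex"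
  assumes F: "finite F"
    and deriv: "\<And>x \<xi>. ((\<lambda>x. b x \<xi>) has_vector_derivative b' x \<xi>) (at x)"
    and cont: "\<And>\<xi>. continuous_on UNIV (\<lambda>x. b' x \<xi>)"
    and b: "\<And>x \<xi>. \<xi> \<in> F \<Longrightarrow> cmod (b x \<xi>) \<le> w \<xi>"
    and b': "\<And>x \<xi>. \<xi> \<in> F \<Longrightarrow> cmod (b' x \<xi>) \<le> w \<xi>"
  shows "(\<integral>x. (cmod (trig_poly F (\<lambda>\<xi>. b x \<xi> * c \<xi>) x))\<^sup>2 \<partial>torus_measure)
    \<le> 130 * (\<Sum>\<xi>\<in>F. (w \<xi> * cmod (c \<xi>))\<^sup>2)"
proof -
  define h where "h t x = trig_poly F (\<lambda>\<xi>. b' t \<xi> * c \<xi>) x" for t x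
  define h0 where "h0 = trig_poly F (\<lambda>\<xi>. b 0 \<xi> * c \<xi>)"
  define S where "S = (\<Sum>\<xi>\<in>F. (w \<xi> * cmod (c \<xi>))\<^sup>2)"
  interpret P: pair_prob_space torus_measure torus_measure ..
  have contb: "continuous_on UNIV (\<lambda>x. b x \<xi>)" for \<xi>
    using deriv by (meson continuous_at_imp_continuous_on has_vector_derivative_continuous)
  have cont_h: "continuous_on UNIV (\<lambda>(t, x). (cmod (h t x))\<^sup>2)"
    unfolding h_def trig_poly_def case_prod_unfold
    by (intro continuous_intros continuous_on_compose2[OF cont]) auto
  have cont_ht: "continuous_on UNIV (\<lambda>t. (cmod (h t x)))" for x
    unfolding h_def trig_poly_def by (intro continuous_intros cont)
  have h_bound: "cmod (h t x) \<le> (\<Sum>\<xi>\<in>F. w \<xi> * cmod (c \<xi>))" for t x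
    unfolding h_def trig_poly_def
    by (intro sum_norm_le) (auto simp: norm_mult intro!: mult_right_mono b')
  have int_h: "integrable (torus_measure \<Otimes>\<^sub>M torus_measure) (\<lambda>(t, x). (cmod (h t x))\<^sup>2)"
  proof (rule P.integrable_const_bound)
    show "AE z in torus_measure \<Otimes>\<^sub>M torus_measure.
        norm (case z of (t, x) \<Rightarrow> (cmod (h t x))\<^sup>2) \<le> (\<Sum>\<xi>\<in>F. w \<xi> * cmod (c \<xi>))\<^sup>2"
      by (auto intro!: AE_I2 power_mono h_bound)
    have "(\<lambda>(t, x). (cmod (h t x))\<^sup>2) \<in> borel_measurable (borel \<Otimes>\<^sub>M borel)"
      using borel_measurable_continuous_onI[OF cont_h] by (simp add: borel_prod)
    then show "(\<lambda>(t, x). (cmod (h t x))\<^sup>2) \<in> borel_measurable (torus_measure \<Otimes>\<^sub>M torus_measure)"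
      by (simp cong: measurable_cong_sets sets_pair_measure_cong)
  qed
  have int_h': "integrable (torus_measure \<Otimes>\<^sub>M torus_measure) (\<lambda>(x, t). (cmod (h t x))\<^sup>2)"
    using P.integrable_product_swap[OF int_h] by (simp add: case_prod_unfold)
  define V where "V x = (\<integral>t. (cmod (h t x))\<^sup>2 \<partial>torus_measure)" for x
  have int_V: "integrable torus_measure V"
    unfolding V_def using P.integrable_fst[OF int_h'] by simp
  have slice: "(\<integral>x. (cmod (h t x))\<^sup>2 \<partial>torus_measure) \<le> S" for t
    unfolding h_def parseval_trig_poly[OF F] S_def
    by (auto intro!: sum_mono power_mono mult_right_mono b' simp: norm_mult)
  have start: "(\<integral>x. (cmod (h0 x))\<^sup>2 \<partial>torus_measure) \<le> S"
    unfolding h0_def parseval_trig_poly[OF F] S_def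
    by (auto intro!: sum_mono power_mono mult_right_mono b simp: norm_mult)
  have "(\<integral>x. V x \<partial>torus_measure) = (\<integral>t. (\<integral>x. (cmod (h t x))\<^sup>2 \<partial>torus_measure) \<partial>torus_measure)"
    unfolding V_def by (rule P.Fubini_integral[OF int_h])
  also have "\<dots> \<le> (\<integral>t. S \<partial>torus_measure)"
    using P.integrable_fst[OF int_h] by (intro integral_mono slice) auto
  finally have int_V_le: "(\<integral>x. V x \<partial>torus_measure) \<le> S"
    by (simp add: torus.prob_space)
  have pointwise: "(cmod (trig_poly F (\<lambda>\<xi>. b x \<xi> * c \<xi>) x))\<^sup>2 \<le> 2 * (cmod (h0 x))\<^sup>2 + 128 * V x"
    if x: "0 \<le> x" "x \<le> 2 * pi" for x
  proof -
    define I where "I = (\<integral>t. cmod (h t x) \<partial>torus_measure)"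
    have D: "((\<lambda>t. trig_poly F (\<lambda>\<xi>. b t \<xi> * c \<xi>) x) has_vector_derivative h t x) (at t)" for t
      unfolding trig_poly_def h_def
      by (intro has_vector_derivative_sum has_vector_derivative_mult_right
          has_vector_derivative_mult_left deriv)
    have "continuous_on UNIV (\<lambda>t. h t x)"
      unfolding h_def trig_poly_def by (intro continuous_intros cont)
    from norm_le_start_plus_variation[OF D this x]
    have "(cmod (trig_poly F (\<lambda>\<xi>. b x \<xi> * c \<xi>) x))\<^sup>2 \<le> (cmod (h0 x) + 2 * pi * I)\<^sup>2"
      by (intro power_mono) (auto simp: h0_def I_def)
    also have "\<dots> \<le> 2 * (cmod (h0 x))\<^sup>2 + (8 * pi\<^sup>2) * I\<^sup>2"
      using power2_add_le[of "cmod (h0 x)" "2 * pi * I"] by (simp add: power_mult_distrib)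
    also have "(8 * pi\<^sup>2) * I\<^sup>2 \<le> 128 * V x"
    proof (rule mult_mono)
      have "pi\<^sup>2 \<le> 4\<^sup>2"
        using pi_less_4 by (intro power_mono) auto
      then show "8 * pi\<^sup>2 \<le> 128" by simp
      show "I\<^sup>2 \<le> V x"
        unfolding I_def V_def by (rule square_integral_le_integral_square[OF cont_ht])
    qed auto
    finally show ?thesis by simp
  qed
  have "(\<integral>x. (cmod (trig_poly F (\<lambda>\<xi>. b x \<xi> * c \<xi>) x))\<^sup>2 \<partial>torus_measure)
      \<le> (\<integral>x. 2 * (cmod (h0 x))\<^sup>2 + 128 * V x \<partial>torus_measure)"
  proof (rule integral_mono_AE)
    show "integrable torus_measure (\<lambda>x. (cmod (trig_poly F (\<lambda>\<xi>. b x \<xi> * c \<xi>) x))\<^sup>2)"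
      unfolding trig_poly_def by (intro integrable_torus_measure continuous_intros contb)
    show "integrable torus_measure (\<lambda>x. 2 * (cmod (h0 x))\<^sup>2 + 128 * V x)"
      unfolding h0_def
      by (intro Bochner_Integration.integrable_add integrable_mult_right int_V
          integrable_torus_measure continuous_intros continuous_on_trig_poly)
    show "AE x in torus_measure. (cmod (trig_poly F (\<lambda>\<xi>. b x \<xi> * c \<xi>) x))\<^sup>2
        \<le> 2 * (cmod (h0 x))\<^sup>2 + 128 * V x"
      using AE_torus_measure by eventually_elim (use pointwise in auto)
  qed
  also have "\<dots> = 2 * (\<integral>x. (cmod (h0 x))\<^sup>2 \<partial>torus_measure) + 128 * (\<integral>x. V x \<partial>torus_measure)"
  proof -
    have "integrable torus_measure (\<lambda>x. (cmod (h0 x))\<^sup>2)"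
      unfolding h0_def by (intro integrable_torus_measure continuous_intros continuous_on_trig_poly)
    with int_V show ?thesis by simp
  qed
  also have "\<dots> \<le> 2 * S + 128 * S"
    using start int_V_le by simp
  finally show ?thesis by (simp add: S_def)
qed

section \<open>A square-summable weight on the frequencies\<close>

definition bracket :: "int \<Rightarrow> real" where
  "bracket \<xi> = max 1 \<bar>of_int \<xi>\<bar>"

lemma bracket_ge_1: "1 \<le> bracket \<xi>"
  by (simp add: bracket_def)

lemma bracket_pos: "0 < bracket \<xi>"
  using bracket_ge_1[of \<xi>] by linarith

lemma bracket_neq_0: "bracket \<xi> \<noteq> 0"
  using bracket_pos[of \<xi>] by simp

text \<open>Telescoping, from \<open>1 / (n + 1)\<^sup>2 \<le> 1 / n - 1 / (n + 1)\<close>.\<close>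

lemma sum_inverse_bracket_square_le:
  assumes "finite F"
  shows "(\<Sum>\<xi>\<in>F. (1 / bracket \<xi>)\<^sup>2) \<le> 5"
proof -
  have sym: "(\<Sum>\<xi>\<in>{- int n..int n}. (1 / bracket \<xi>)\<^sup>2) \<le> 5 - 2 / real n" if "n \<ge> 1" for n
    using that
  proof (induction n rule: nat_induct_at_least)
    case base
    have "{- int 1..int 1} = {-1, 0, 1}" by auto
    then show ?case by (simp add: bracket_def)
  next
    case (Suc n)
    have "{- int (Suc n)..int (Suc n)} = insert (int (Suc n)) (insert (- int (Suc n)) {- int n..int n})"
      by auto
    then have "(\<Sum>\<xi>\<in>{- int (Suc n)..int (Suc n)}. (1 / bracket \<xi>)\<^sup>2)
        = 2 / (real (Suc n))\<^sup>2 + (\<Sum>\<xi>\<in>{- int n..int n}. (1 / bracket \<xi>)\<^sup>2)"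
      by (simp add: bracket_def max_def power_one_over) (simp add: add.commute)
    also have "\<dots> \<le> 2 / (real (Suc n))\<^sup>2 + (5 - 2 / real n)"
      using Suc.IH by simp
    also have "2 / (real (Suc n))\<^sup>2 \<le> 2 / (real n * real (Suc n))"
      using Suc.hyps by (intro divide_left_mono) (auto simp: power2_eq_square)
    also have "2 / (real n * real (Suc n)) = 2 / real n - 2 / real (Suc n)"
      using Suc.hyps by (simp add: field_simps)
    finally show ?case by simp
  qed
  obtain n :: nat where n: "\<And>\<xi>. \<xi> \<in> F \<Longrightarrow> \<bar>\<xi>\<bar> \<le> int n"
  proof
    show "\<bar>\<xi>\<bar> \<le> int (nat (\<Sum>\<eta>\<in>F. \<bar>\<eta>\<bar>))" if "\<xi> \<in> F" for \<xi>
      using member_le_sum[OF that, of abs] assms by (simp add: sum_nonneg)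
  qed
  have "F \<subseteq> {- int (Suc n)..int (Suc n)}"
    using n by fastforce
  then have "(\<Sum>\<xi>\<in>F. (1 / bracket \<xi>)\<^sup>2) \<le> (\<Sum>\<xi>\<in>{- int (Suc n)..int (Suc n)}. (1 / bracket \<xi>)\<^sup>2)"
    by (intro sum_mono2) auto
  also have "\<dots> \<le> 5 - 2 / real (Suc n)"
    by (rule sym) simp
  also have "\<dots> \<le> 5" by simp
  finally show ?thesis .
qed

lemma fourier_coeff_add:
  assumes "continuous_on UNIV f" "continuous_on UNIV g"
  shows "fourier_coeff (\<lambda>x. f x + g x) \<xi> = fourier_coeff f \<xi> + fourier_coeff g \<xi>"
proof -
  have "integrable torus_measure (\<lambda>x. cis (- (x * of_int \<xi>)) * f x)"
       "integrable torus_measure (\<lambda>x. cis (- (x * of_int \<xi>)) * g x)"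
    by (intro integrable_torus_measure continuous_intros assms)+
  then show ?thesis
    by (simp add: fourier_coeff_def distrib_left)
qed

lemma fourier_coeff_uniform_limit:
  assumes lim: "uniform_limit UNIV f g A" and cont: "\<And>n. continuous_on UNIV (f n)"
    and g: "continuous_on UNIV g"
  shows "((\<lambda>n. fourier_coeff (f n) \<xi>) \<longlongrightarrow> fourier_coeff g \<xi>) A"
proof (rule tendstoI)
  fix e :: real assume "e > 0"
  then have "\<forall>\<^sub>F n in A. \<forall>x\<in>UNIV. dist (f n x) (g x) < e / 2"
    by (intro uniform_limitD[OF lim]) simp
  then show "\<forall>\<^sub>F n in A. dist (fourier_coeff (f n) \<xi>) (fourier_coeff g \<xi>) < e"
  proof eventually_elim
    case (elim n)
    have int: "integrable torus_measure (\<lambda>x. cis (- (x * of_int \<xi>)) * f n x)"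
       "integrable torus_measure (\<lambda>x. cis (- (x * of_int \<xi>)) * g x)"
      by (intro integrable_torus_measure continuous_intros cont g)+
    then have "fourier_coeff (f n) \<xi> - fourier_coeff g \<xi>
        = (\<integral>x. cis (- (x * of_int \<xi>)) * f n x - cis (- (x * of_int \<xi>)) * g x \<partial>torus_measure)"
      by (simp add: fourier_coeff_def)
    also have "norm \<dots> \<le> (\<integral>x. e / 2 \<partial>torus_measure)"
    proof (rule Bochner_Integration.integral_norm_bound_integral)
      show "norm (cis (- (x * of_int \<xi>)) * f n x - cis (- (x * of_int \<xi>)) * g x) \<le> e / 2" for x
        using elim by (auto simp: dist_norm norm_mult less_imp_le simp flip: right_diff_distrib)
    qed (use int in simp_all)
    also have "\<dots> < e"
      using \<open>e > 0\<close> by (simp add: torus.prob_space)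
    finally show ?case by (simp add: dist_norm)
  qed
qed

section \<open>Decay of the Fourier coefficients of the image\<close>

text \<open>A symbol \<open>b\<close> with \<open>x\<close>-derivative \<open>b'\<close>. The bracket in place of \<open>\<bar>\<xi>\<bar>\<close> lets the estimates include the
  frequency \<open>0\<close>.\<close>

locale periodic_symbol =
  fixes b b' :: "real \<Rightarrow> int \<Rightarrow> complex" and C \<rho> :: real
  assumes deriv: "\<And>x \<xi>. ((\<lambda>x. b x \<xi>) has_vector_derivative b' x \<xi>) (at x)"
    and cont_deriv: "\<And>\<xi>. continuous_on UNIV (\<lambda>x. b' x \<xi>)"
    and periodic: "\<And>\<xi>. b (2 * pi) \<xi> = b 0 \<xi>"
    and bound: "\<And>x \<xi>. cmod (b x \<xi>) \<le> C * bracket \<xi> powr (- \<rho>)"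
    and deriv_bound: "\<And>x \<xi>. cmod (b' x \<xi>) \<le> C * bracket \<xi> powr (- \<rho>)"
    and order: "0 \<le> \<rho>" "\<rho> \<le> 1"
begin

lemma C_nonneg: "0 \<le> C"
  using order_trans[OF norm_ge_zero bound[of 0 0]] by (simp add: bracket_def)

lemma continuous_symbol: "continuous_on UNIV (\<lambda>x. b x \<xi>)"
  using deriv by (meson continuous_at_imp_continuous_on has_vector_derivative_continuous)

definition partial_Op :: "int set \<Rightarrow> (int \<Rightarrow> complex) \<Rightarrow> real \<Rightarrow> complex" where
  "partial_Op F c x = trig_poly F (\<lambda>\<xi>. b x \<xi> * c \<xi>) x"

definition partial_Op_deriv :: "int set \<Rightarrow> (int \<Rightarrow> complex) \<Rightarrow> real \<Rightarrow> complex" where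
  "partial_Op_deriv F c x =
     trig_poly F (\<lambda>\<xi>. b x \<xi> * (\<i> * of_int \<xi> * c \<xi>)) x + trig_poly F (\<lambda>\<xi>. b' x \<xi> * c \<xi>) x"

lemma continuous_partial_Op: "continuous_on UNIV (partial_Op F c)"
  unfolding partial_Op_def trig_poly_def by (intro continuous_intros continuous_symbol)

lemma continuous_partial_Op_deriv: "continuous_on UNIV (partial_Op_deriv F c)"
  unfolding partial_Op_deriv_def trig_poly_def
  by (intro continuous_intros continuous_symbol cont_deriv)

lemma has_vector_derivative_partial_Op:
  "(partial_Op F c has_vector_derivative partial_Op_deriv F c x) (at x)"
proof -
  have "((\<lambda>x. \<Sum>\<xi>\<in>F. cis (x * of_int \<xi>) * (b x \<xi> * c \<xi>)) has_vector_derivative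
      (\<Sum>\<xi>\<in>F. cis (x * of_int \<xi>) * (b' x \<xi> * c \<xi>)
        + \<i> * of_real (of_int \<xi>) * cis (x * of_int \<xi>) * (b x \<xi> * c \<xi>))) (at x)"
    by (intro has_vector_derivative_sum has_vector_derivative_mult has_vector_derivative_cis
        has_vector_derivative_mult_left deriv)
  moreover have "(\<Sum>\<xi>\<in>F. cis (x * of_int \<xi>) * (b' x \<xi> * c \<xi>)
        + \<i> * of_real (of_int \<xi>) * cis (x * of_int \<xi>) * (b x \<xi> * c \<xi>)) = partial_Op_deriv F c x"
    by (simp add: partial_Op_deriv_def trig_poly_def sum.distrib mult_ac)
  ultimately show ?thesis
    by (simp add: partial_Op_def[abs_def] trig_poly_def)
qed

text \<open>As \<open>\<rho> \<ge> 0\<close>, the weight \<open>bracket \<xi> powr (- \<rho>)\<close> is largest at the lowest frequency.\<close>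

lemma high_frequency_bound:
  assumes F: "finite F" and "0 < N" and N: "\<And>\<xi>. \<xi> \<in> F \<Longrightarrow> N \<le> bracket \<xi>"
  shows "(\<integral>x. (cmod (partial_Op F c x))\<^sup>2 \<partial>torus_measure)
    \<le> 130 * (C * N powr (- \<rho>))\<^sup>2 * (\<Sum>\<xi>\<in>F. (cmod (c \<xi>))\<^sup>2)"
proof -
  have w: "C * bracket \<xi> powr (- \<rho>) \<le> C * N powr (- \<rho>)" if "\<xi> \<in> F" for \<xi>
    using N[OF that] \<open>0 < N\<close> order C_nonneg
    by (intro mult_left_mono powr_mono2') auto
  have "(\<integral>x. (cmod (partial_Op F c x))\<^sup>2 \<partial>torus_measure)
      \<le> 130 * (\<Sum>\<xi>\<in>F. ((C * N powr (- \<rho>)) * cmod (c \<xi>))\<^sup>2)"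
    unfolding partial_Op_def
    by (rule variable_coefficient_L2_bound[OF F deriv cont_deriv])
      (use w bound deriv_bound in \<open>blast intro: order_trans\<close>)+
  then show ?thesis
    by (simp add: power_mult_distrib sum_distrib_left mult.assoc)
qed

text \<open>The derivative has two parts. Where it falls on the exponential, the symbol becomes \<open>\<i>\<xi> b\<close>, of size
  \<open>N powr (1 - \<rho>)\<close> together with its \<open>x\<close>-derivative, and the \<open>L\<^sup>2\<close> bound applies. Where it falls on the symbol,
  no further derivative is available for that bound, and the sum is estimated at each point by the
  Cauchy--Schwarz inequality. For this, \<open>\<rho> \<le> 1\<close> allows trading \<open>bracket \<xi> powr (- \<rho>)\<close> for
  \<open>N powr (1 - \<rho>)\<close> times the square-summable \<open>1 / bracket \<xi>\<close>.\<close>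

lemma low_frequency_derivative_bound:
  assumes F: "finite F" and N: "\<And>\<xi>. \<xi> \<in> F \<Longrightarrow> bracket \<xi> \<le> N"
  shows "(\<integral>x. (cmod (partial_Op_deriv F c x))\<^sup>2 \<partial>torus_measure)
    \<le> 270 * (C * N powr (1 - \<rho>))\<^sup>2 * (\<Sum>\<xi>\<in>F. (cmod (c \<xi>))\<^sup>2)"
proof -
  define A where "A = C * N powr (1 - \<rho>)"
  define S where "S = (\<Sum>\<xi>\<in>F. (cmod (c \<xi>))\<^sup>2)"
  define g1 where "g1 x = trig_poly F (\<lambda>\<xi>. b x \<xi> * (\<i> * of_int \<xi> * c \<xi>)) x" for x
  define g2 where "g2 x = trig_poly F (\<lambda>\<xi>. b' x \<xi> * c \<xi>) x" for x
  have cont: "continuous_on UNIV g1" "continuous_on UNIV g2"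
    unfolding g1_def g2_def trig_poly_def
    by (intro continuous_intros continuous_symbol cont_deriv)+
  have weight: "C * bracket \<xi> powr (- \<rho>) * bracket \<xi> \<le> A" if "\<xi> \<in> F" for \<xi>
  proof -
    have "bracket \<xi> powr (- \<rho>) * bracket \<xi> = bracket \<xi> powr (1 - \<rho>)"
      using bracket_pos[of \<xi>] powr_add[of "bracket \<xi>" "- \<rho>" 1] by simp
    also have "\<dots> \<le> N powr (1 - \<rho>)"
      using N[OF that] bracket_pos[of \<xi>] order by (intro powr_mono2) auto
    finally show ?thesis
      unfolding A_def using C_nonneg by (simp add: mult_left_mono mult.assoc)
  qed
  have g1: "(\<integral>x. (cmod (g1 x))\<^sup>2 \<partial>torus_measure) \<le> 130 * (A\<^sup>2 * S)"
  proof -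
    have "(\<integral>x. (cmod (g1 x))\<^sup>2 \<partial>torus_measure)
        \<le> 130 * (\<Sum>\<xi>\<in>F. (C * bracket \<xi> powr (- \<rho>) * cmod (\<i> * of_int \<xi> * c \<xi>))\<^sup>2)"
      unfolding g1_def
      by (rule variable_coefficient_L2_bound[OF F deriv cont_deriv bound deriv_bound])
    also have "(\<Sum>\<xi>\<in>F. (C * bracket \<xi> powr (- \<rho>) * cmod (\<i> * of_int \<xi> * c \<xi>))\<^sup>2)
        \<le> (\<Sum>\<xi>\<in>F. (A * cmod (c \<xi>))\<^sup>2)"
    proof (intro sum_mono power_mono)
      fix \<xi> assume "\<xi> \<in> F"
      have "C * bracket \<xi> powr (- \<rho>) * cmod (\<i> * of_int \<xi> * c \<xi>)
          \<le> C * bracket \<xi> powr (- \<rho>) * (bracket \<xi> * cmod (c \<xi>))"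
        using C_nonneg
        by (intro mult_left_mono) (auto simp: norm_mult bracket_def intro!: mult_right_mono)
      also have "\<dots> \<le> A * cmod (c \<xi>)"
        using mult_right_mono[OF weight[OF \<open>\<xi> \<in> F\<close>], of "cmod (c \<xi>)"] by (simp add: mult.assoc)
      finally show "C * bracket \<xi> powr (- \<rho>) * cmod (\<i> * of_int \<xi> * c \<xi>) \<le> A * cmod (c \<xi>)" .
    qed (use C_nonneg in auto)
    finally show ?thesis
      by (simp add: S_def power_mult_distrib sum_distrib_left)
  qed
  have g2: "(\<integral>x. (cmod (g2 x))\<^sup>2 \<partial>torus_measure) \<le> 5 * (A\<^sup>2 * S)"
  proof -
    have "(cmod (g2 x))\<^sup>2 \<le> 5 * (A\<^sup>2 * S)" for x
    proof -
      have "cmod (g2 x) \<le> (\<Sum>\<xi>\<in>F. (A * (1 / bracket \<xi>)) * cmod (c \<xi>))"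
        unfolding g2_def trig_poly_def
      proof (rule sum_norm_le)
        fix \<xi> assume "\<xi> \<in> F"
        have "C * bracket \<xi> powr (- \<rho>) \<le> A * (1 / bracket \<xi>)"
          using weight[OF \<open>\<xi> \<in> F\<close>] bracket_pos[of \<xi>] by (simp add: field_simps)
        with deriv_bound[of x \<xi>] show "norm (cis (x * of_int \<xi>) * (b' x \<xi> * c \<xi>))
            \<le> (A * (1 / bracket \<xi>)) * cmod (c \<xi>)"
          unfolding norm_mult norm_cis mult_1 by (intro mult_right_mono) auto
      qed
      then have "(cmod (g2 x))\<^sup>2 \<le> (\<Sum>\<xi>\<in>F. (A * (1 / bracket \<xi>)) * cmod (c \<xi>))\<^sup>2"
        by (rule power_mono) simp
      also have "\<dots> \<le> (\<Sum>\<xi>\<in>F. (A * (1 / bracket \<xi>))\<^sup>2) * S"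
        unfolding S_def by (rule Cauchy_Schwarz_ineq_sum)
      also have "(\<Sum>\<xi>\<in>F. (A * (1 / bracket \<xi>))\<^sup>2) = A\<^sup>2 * (\<Sum>\<xi>\<in>F. (1 / bracket \<xi>)\<^sup>2)"
        by (simp only: power_mult_distrib sum_distrib_left)
      also have "\<dots> * S \<le> (A\<^sup>2 * 5) * S"
        using sum_inverse_bracket_square_le[OF F]
        by (intro mult_right_mono mult_left_mono) (auto simp: S_def sum_nonneg)
      finally show ?thesis by simp
    qed
    then have "(\<integral>x. (cmod (g2 x))\<^sup>2 \<partial>torus_measure) \<le> (\<integral>x. 5 * (A\<^sup>2 * S) \<partial>torus_measure)"
      by (intro integral_mono integrable_torus_measure continuous_intros cont)
    then show ?thesis by (simp add: torus.prob_space)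
  qed
  have int: "integrable torus_measure (\<lambda>x. (cmod (g1 x))\<^sup>2)"
    "integrable torus_measure (\<lambda>x. (cmod (g2 x))\<^sup>2)"
    by (intro integrable_torus_measure continuous_intros cont)+
  have "(\<integral>x. (cmod (partial_Op_deriv F c x))\<^sup>2 \<partial>torus_measure)
      \<le> (\<integral>x. 2 * (cmod (g1 x))\<^sup>2 + 2 * (cmod (g2 x))\<^sup>2 \<partial>torus_measure)"
  proof (rule integral_mono)
    show "(cmod (partial_Op_deriv F c x))\<^sup>2 \<le> 2 * (cmod (g1 x))\<^sup>2 + 2 * (cmod (g2 x))\<^sup>2" for x
      unfolding partial_Op_deriv_def g1_def g2_def
      by (rule order_trans[OF power_mono[OF norm_triangle_ineq norm_ge_zero] power2_add_le])
  qed (intro integrable_torus_measure continuous_intros cont continuous_partial_Op_deriv)+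
  also have "\<dots> = 2 * (\<integral>x. (cmod (g1 x))\<^sup>2 \<partial>torus_measure)
      + 2 * (\<integral>x. (cmod (g2 x))\<^sup>2 \<partial>torus_measure)"
    using int by simp
  also have "\<dots> \<le> 2 * (130 * (A\<^sup>2 * S)) + 2 * (5 * (A\<^sup>2 * S))"
    by (intro add_mono mult_left_mono g1 g2) auto
  also have "\<dots> = 270 * A\<^sup>2 * S"
    by simp
  finally show ?thesis
    unfolding A_def S_def .
qed

text \<open>Split the input at the frequency \<open>N\<close>. The high part is already small by the factor \<open>N powr (- \<rho>)\<close>. The
  image of the low part is differentiated: at output frequencies \<open>\<bar>\<eta>\<bar> \<ge> N\<close> this gains a factor \<open>1 / N\<close>, which
  turns the bound \<open>N powr (1 - \<rho>)\<close> for the derivative into \<open>N powr (- \<rho>)\<close>.\<close>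

lemma partial_Op_coeff_bound:
  assumes F: "finite F" and J: "finite J" and "1 \<le> N"
    and N: "\<And>\<eta>. \<eta> \<in> J \<Longrightarrow> N \<le> \<bar>of_int \<eta>\<bar>"
  shows "(\<Sum>\<eta>\<in>J. (cmod (fourier_coeff (partial_Op F c) \<eta>))\<^sup>2)
    \<le> 800 * (C * N powr (- \<rho>))\<^sup>2 * (\<Sum>\<xi>\<in>F. (cmod (c \<xi>))\<^sup>2)"
proof -
  define S where "S = (\<Sum>\<xi>\<in>F. (cmod (c \<xi>))\<^sup>2)"
  define A where "A = C * N powr (- \<rho>)"
  define L where "L = {\<xi>\<in>F. bracket \<xi> < N}"
  define H where "H = {\<xi>\<in>F. N \<le> bracket \<xi>}"
  have LH: "finite L" "finite H" "F = L \<union> H" "L \<inter> H = {}"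
    using F by (auto simp: L_def H_def)
  have S_mono: "(\<Sum>\<xi>\<in>G. (cmod (c \<xi>))\<^sup>2) \<le> S" if "G \<subseteq> F" for G
    unfolding S_def using F that by (intro sum_mono2) auto
  have split: "partial_Op F c = (\<lambda>x. partial_Op L c x + partial_Op H c x)"
    unfolding partial_Op_def[abs_def] trig_poly_def LH(3) sum.union_disjoint[OF LH(1,2,4)] ..
  have high: "(\<Sum>\<eta>\<in>J. (cmod (fourier_coeff (partial_Op H c) \<eta>))\<^sup>2) \<le> 130 * (A\<^sup>2 * S)"
  proof -
    have "(\<Sum>\<eta>\<in>J. (cmod (fourier_coeff (partial_Op H c) \<eta>))\<^sup>2)
        \<le> (\<integral>x. (cmod (partial_Op H c x))\<^sup>2 \<partial>torus_measure)"
      by (rule bessel_inequality[OF J continuous_partial_Op])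
    also have "\<dots> \<le> 130 * A\<^sup>2 * (\<Sum>\<xi>\<in>H. (cmod (c \<xi>))\<^sup>2)"
      unfolding A_def using \<open>1 \<le> N\<close> LH(2) by (intro high_frequency_bound) (auto simp: H_def)
    also have "\<dots> \<le> 130 * A\<^sup>2 * S"
      by (intro mult_left_mono S_mono) (auto simp: H_def)
    finally show ?thesis by simp
  qed
  have low: "(\<Sum>\<eta>\<in>J. (cmod (fourier_coeff (partial_Op L c) \<eta>))\<^sup>2) \<le> 270 * (A\<^sup>2 * S)"
  proof -
    have coeff: "fourier_coeff (partial_Op_deriv L c) \<eta>
        = \<i> * of_int \<eta> * fourier_coeff (partial_Op L c) \<eta>" for \<eta>
    proof (rule fourier_coeff_derivative[OF has_vector_derivative_partial_Op
          continuous_partial_Op_deriv])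
      show "partial_Op L c (2 * pi) = partial_Op L c 0"
        by (simp add: partial_Op_def trig_poly_def cis_2pi_int periodic)
    qed
    have "N\<^sup>2 * (\<Sum>\<eta>\<in>J. (cmod (fourier_coeff (partial_Op L c) \<eta>))\<^sup>2)
        \<le> (\<Sum>\<eta>\<in>J. (cmod (fourier_coeff (partial_Op_deriv L c) \<eta>))\<^sup>2)"
      unfolding sum_distrib_left
    proof (rule sum_mono)
      fix \<eta> assume "\<eta> \<in> J"
      have "N\<^sup>2 \<le> \<bar>real_of_int \<eta>\<bar>\<^sup>2"
        using N[OF \<open>\<eta> \<in> J\<close>] \<open>1 \<le> N\<close> by (intro power_mono) auto
      then show "N\<^sup>2 * (cmod (fourier_coeff (partial_Op L c) \<eta>))\<^sup>2
          \<le> (cmod (fourier_coeff (partial_Op_deriv L c) \<eta>))\<^sup>2"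
        unfolding coeff by (simp add: norm_mult power_mult_distrib mult_right_mono)
    qed
    also have "\<dots> \<le> (\<integral>x. (cmod (partial_Op_deriv L c x))\<^sup>2 \<partial>torus_measure)"
      by (rule bessel_inequality[OF J continuous_partial_Op_deriv])
    also have "\<dots> \<le> 270 * (C * N powr (1 - \<rho>))\<^sup>2 * (\<Sum>\<xi>\<in>L. (cmod (c \<xi>))\<^sup>2)"
      using LH(1) by (intro low_frequency_derivative_bound) (auto simp: L_def)
    also have "\<dots> \<le> 270 * (C * N powr (1 - \<rho>))\<^sup>2 * S"
      by (intro mult_left_mono S_mono) (auto simp: L_def)
    also have "C * N powr (1 - \<rho>) = N * A"
      using \<open>1 \<le> N\<close> powr_add[of N 1 "- \<rho>"] by (simp add: A_def)
    also have "270 * (N * A)\<^sup>2 * S = N\<^sup>2 * (270 * (A\<^sup>2 * S))"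
      by (simp add: power_mult_distrib)
    finally have "N\<^sup>2 * (\<Sum>\<eta>\<in>J. (cmod (fourier_coeff (partial_Op L c) \<eta>))\<^sup>2)
        \<le> N\<^sup>2 * (270 * (A\<^sup>2 * S))" .
    then show ?thesis
      using \<open>1 \<le> N\<close> by simp
  qed
  have "(\<Sum>\<eta>\<in>J. (cmod (fourier_coeff (partial_Op F c) \<eta>))\<^sup>2)
      \<le> (\<Sum>\<eta>\<in>J. 2 * (cmod (fourier_coeff (partial_Op L c) \<eta>))\<^sup>2
          + 2 * (cmod (fourier_coeff (partial_Op H c) \<eta>))\<^sup>2)"
    unfolding split fourier_coeff_add[OF continuous_partial_Op continuous_partial_Op]
    by (intro sum_mono order_trans[OF power_mono[OF norm_triangle_ineq norm_ge_zero] power2_add_le])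
  also have "\<dots> \<le> 2 * (270 * (A\<^sup>2 * S)) + 2 * (130 * (A\<^sup>2 * S))"
    unfolding sum.distrib sum_distrib_left[symmetric]
    by (intro add_mono mult_left_mono low high) auto
  also have "\<dots> = 800 * A\<^sup>2 * S"
    by simp
  finally show ?thesis
    unfolding A_def S_def .
qed

text \<open>The bound for finitely many frequencies is uniform, and absolute summability of the coefficients makes
  the partial sums converge uniformly, so it survives the limit.\<close>

lemma Op_coeff_bound:
  assumes summ: "(\<lambda>\<xi>. cmod (fourier_coeff f \<xi>)) summable_on UNIV"
    and l2: "\<And>F. finite F \<Longrightarrow> (\<Sum>\<xi>\<in>F. (cmod (fourier_coeff f \<xi>))\<^sup>2) \<le> H\<^sup>2"
    and J: "finite J" and "1 \<le> N" and N: "\<And>\<eta>. \<eta> \<in> J \<Longrightarrow> N \<le> \<bar>of_int \<eta>\<bar>"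
  shows "(\<Sum>\<eta>\<in>J. (cmod (fourier_coeff (Op b f) \<eta>))\<^sup>2) \<le> 800 * (C * N powr (- \<rho>) * H)\<^sup>2"
proof -
  define c where "c = fourier_coeff f"
  have bnd: "cmod (b x \<xi>) \<le> C" for x \<xi>
  proof -
    have "bracket \<xi> powr (- \<rho>) \<le> 1"
      using powr_mono[of "- \<rho>" 0 "bracket \<xi>"] bracket_ge_1[of \<xi>] order by simp
    then have "C * bracket \<xi> powr (- \<rho>) \<le> C"
      using C_nonneg by (metis mult_left_mono mult.right_neutral)
    with bound[of x \<xi>] show ?thesis by linarith
  qed
  have "uniform_limit UNIV (\<lambda>F x. \<Sum>\<xi>\<in>F. cis (x * of_int \<xi>) * b x \<xi> * c \<xi>) (Op b f)
      (finite_subsets_at_top UNIV)"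
    unfolding Op_def[abs_def] c_def
  proof (rule Weierstrass_m_test_general)
    show "(\<lambda>\<xi>. C * cmod (fourier_coeff f \<xi>)) summable_on UNIV"
      by (rule summable_on_cmult_right[OF summ])
  qed (simp add: norm_mult mult_right_mono bnd)
  then have lim: "uniform_limit UNIV (\<lambda>F. partial_Op F c) (Op b f) (finite_subsets_at_top UNIV)"
    by (simp add: partial_Op_def[abs_def] trig_poly_def mult.assoc)
  have cont: "continuous_on UNIV (Op b f)"
    by (rule uniform_limit_theorem[OF _ lim]) (auto intro!: always_eventually continuous_partial_Op)
  have "((\<lambda>F. \<Sum>\<eta>\<in>J. (cmod (fourier_coeff (partial_Op F c) \<eta>))\<^sup>2)
      \<longlongrightarrow> (\<Sum>\<eta>\<in>J. (cmod (fourier_coeff (Op b f) \<eta>))\<^sup>2)) (finite_subsets_at_top UNIV)"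
    by (intro tendsto_intros fourier_coeff_uniform_limit[OF lim continuous_partial_Op cont])
  then show ?thesis
  proof (rule tendsto_upperbound)
    show "\<forall>\<^sub>F F in finite_subsets_at_top UNIV.
        (\<Sum>\<eta>\<in>J. (cmod (fourier_coeff (partial_Op F c) \<eta>))\<^sup>2) \<le> 800 * (C * N powr (- \<rho>) * H)\<^sup>2"
    proof (rule eventually_finite_subsets_at_top_weakI)
      fix F :: "int set" assume F: "finite F"
      have "(\<Sum>\<eta>\<in>J. (cmod (fourier_coeff (partial_Op F c) \<eta>))\<^sup>2)
          \<le> 800 * (C * N powr (- \<rho>))\<^sup>2 * (\<Sum>\<xi>\<in>F. (cmod (c \<xi>))\<^sup>2)"
        by (rule partial_Op_coeff_bound[OF F J \<open>1 \<le> N\<close> N])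
      also have "\<dots> \<le> 800 * (C * N powr (- \<rho>))\<^sup>2 * H\<^sup>2"
        unfolding c_def by (intro mult_left_mono l2 F) auto
      finally show "(\<Sum>\<eta>\<in>J. (cmod (fourier_coeff (partial_Op F c) \<eta>))\<^sup>2)
          \<le> 800 * (C * N powr (- \<rho>) * H)\<^sup>2"
        by (simp add: power_mult_distrib mult.assoc)
    qed
  qed simp
qed

end

section \<open>Periodic functions of class \<open>C\<^sup>1\<close>\<close>

lemma Ck_torus_1D:
  assumes "g \<in> Ck_torus 1"
  shows "g (x + 2 * pi) = g x" "(g has_vector_derivative x_deriv g x) (at x)"
    "continuous_on UNIV (x_deriv g)"
  using assms unfolding Ck_torus_def
  by (auto simp: x_deriv_def differentiable_on_def vector_derivative_works)

lemma periodic_x_deriv: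
  assumes "g \<in> Ck_torus 1"
  shows "x_deriv g (x + 2 * pi) = x_deriv g x"
proof -
  have "((g \<circ> (\<lambda>x. x + 2 * pi)) has_vector_derivative 1 *\<^sub>R x_deriv g (x + 2 * pi)) (at x)"
    by (rule vector_diff_chain_at) (auto intro!: derivative_eq_intros Ck_torus_1D(2)[OF assms])
  moreover have "g \<circ> (\<lambda>x. x + 2 * pi) = g"
    by (simp add: fun_eq_iff Ck_torus_1D(1)[OF assms])
  ultimately show ?thesis
    using vector_derivative_unique_at[OF Ck_torus_1D(2)[OF assms]] by simp
qed

lemma periodic_bounded:
  fixes g :: "real \<Rightarrow> complex"
  assumes per: "\<And>x. g (x + 2 * pi) = g x" and cont: "continuous_on UNIV g"
  obtains B where "\<And>x. cmod (g x) \<le> B"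
proof -
  interpret g: periodic_fun_simple g "2 * pi"
    by standard (rule per)
  have "bounded (g ` {0..2 * pi})"
    by (intro compact_imp_bounded compact_continuous_image continuous_on_subset[OF cont]) auto
  then obtain B where B: "\<And>x. x \<in> {0..2 * pi} \<Longrightarrow> cmod (g x) \<le> B"
    unfolding bounded_iff by blast
  have two_pi_pos: "0 < 2 * pi"
    by simp
  have "cmod (g x) \<le> B" for x
  proof -
    define y where "y = x - of_int \<lfloor>x / (2 * pi)\<rfloor> * (2 * pi)"
    have "of_int \<lfloor>x / (2 * pi)\<rfloor> * (2 * pi) \<le> x" "x \<le> (of_int \<lfloor>x / (2 * pi)\<rfloor> + 1) * (2 * pi)"
      using of_int_floor_le[of "x / (2 * pi)"] real_of_int_floor_add_one_ge[of "x / (2 * pi)"]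
      by (simp_all only: pos_le_divide_eq[OF two_pi_pos] pos_divide_le_eq[OF two_pi_pos])
    then have "y \<in> {0..2 * pi}"
      by (simp add: y_def algebra_simps)
    then show ?thesis
      using B[of y] by (simp add: y_def g.minus_of_int)
  qed
  then show ?thesis by (rule that)
qed

text \<open>Bessel's inequality for \<open>f\<close> and its derivative makes \<open>bracket \<xi> * cmod (fourier_coeff f \<xi>)\<close> square
  summable; pair this with \<open>1 / bracket \<xi>\<close> in the Cauchy--Schwarz inequality.\<close>

lemma summable_fourier_coeff:
  assumes f: "f \<in> Ck_torus 1"
  shows "(\<lambda>\<xi>. cmod (fourier_coeff f \<xi>)) summable_on UNIV"
proof (rule nonneg_bdd_above_summable_on)
  have contf: "continuous_on UNIV f"
    using Ck_torus_1D(2)[OF f] by (meson continuous_at_imp_continuous_on has_vector_derivative_continuous)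
  define E where "E = (\<integral>x. (cmod (f x))\<^sup>2 \<partial>torus_measure) + (\<integral>x. (cmod (x_deriv f x))\<^sup>2 \<partial>torus_measure)"
  have coeff: "fourier_coeff (x_deriv f) \<xi> = \<i> * of_int \<xi> * fourier_coeff f \<xi>" for \<xi>
    by (rule fourier_coeff_derivative[OF Ck_torus_1D(2,3)[OF f]])
      (use Ck_torus_1D(1)[OF f, of 0] in simp)
  have "(\<Sum>\<xi>\<in>F. cmod (fourier_coeff f \<xi>)) \<le> sqrt (5 * E)" if F: "finite F" for F
  proof (rule real_le_rsqrt)
    have "(\<Sum>\<xi>\<in>F. (bracket \<xi> * cmod (fourier_coeff f \<xi>))\<^sup>2)
        \<le> (\<Sum>\<xi>\<in>F. (cmod (fourier_coeff f \<xi>))\<^sup>2 + (cmod (fourier_coeff (x_deriv f) \<xi>))\<^sup>2)"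
    proof (rule sum_mono)
      fix \<xi>
      have "(bracket \<xi>)\<^sup>2 \<le> 1 + (of_int \<xi>)\<^sup>2"
        by (simp add: bracket_def max_def)
      then have "(bracket \<xi>)\<^sup>2 * (cmod (fourier_coeff f \<xi>))\<^sup>2
          \<le> (1 + (of_int \<xi>)\<^sup>2) * (cmod (fourier_coeff f \<xi>))\<^sup>2"
        by (rule mult_right_mono) simp
      then show "(bracket \<xi> * cmod (fourier_coeff f \<xi>))\<^sup>2
          \<le> (cmod (fourier_coeff f \<xi>))\<^sup>2 + (cmod (fourier_coeff (x_deriv f) \<xi>))\<^sup>2"
        by (simp add: coeff norm_mult power_mult_distrib distrib_right)
    qed
    also have "\<dots> \<le> E"
      unfolding E_def sum.distrib
      by (intro add_mono bessel_inequality F contf Ck_torus_1D(3)[OF f])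
    finally have weighted: "(\<Sum>\<xi>\<in>F. (bracket \<xi> * cmod (fourier_coeff f \<xi>))\<^sup>2) \<le> E" .
    have "(\<Sum>\<xi>\<in>F. cmod (fourier_coeff f \<xi>))\<^sup>2
        = (\<Sum>\<xi>\<in>F. (1 / bracket \<xi>) * (bracket \<xi> * cmod (fourier_coeff f \<xi>)))\<^sup>2"
      by (simp add: bracket_neq_0)
    also have "\<dots> \<le> (\<Sum>\<xi>\<in>F. (1 / bracket \<xi>)\<^sup>2) * (\<Sum>\<xi>\<in>F. (bracket \<xi> * cmod (fourier_coeff f \<xi>))\<^sup>2)"
      by (rule Cauchy_Schwarz_ineq_sum)
    also have "\<dots> \<le> 5 * E"
      by (intro mult_mono sum_inverse_bracket_square_le F weighted) (auto intro: sum_nonneg)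
    finally show "(\<Sum>\<xi>\<in>F. cmod (fourier_coeff f \<xi>))\<^sup>2 \<le> 5 * E" .
  qed
  then show "bdd_above (sum (\<lambda>\<xi>. cmod (fourier_coeff f \<xi>)) ` {F. F \<subseteq> UNIV \<and> finite F})"
    by (intro bdd_aboveI[of _ "sqrt (5 * E)"]) auto
qed simp

section \<open>From coefficients to the Besov norm\<close>

lemma ennreal_powr_ennreal: "0 \<le> t \<Longrightarrow> ennreal_powr (ennreal t) a = ennreal (t powr a)"
  by (simp add: ennreal_powr_def)

lemma ennreal_powr_mono:
  assumes "t \<le> u" "0 \<le> a"
  shows "ennreal_powr t a \<le> ennreal_powr u a"
proof (cases "u = \<infinity>")
  case False
  with assms(1) have "t \<noteq> \<infinity>" "enn2real t \<le> enn2real u"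
    by (auto simp: top_unique less_top enn2real_mono)
  with False assms(2) show ?thesis
    by (auto simp: ennreal_powr_def intro!: ennreal_leI powr_mono2)
qed (simp add: ennreal_powr_def)

text \<open>Bernstein's inequality from \<open>L\<^sup>2\<close> to \<open>L\<^sup>p\<close>: the Cauchy--Schwarz inequality bounds the supremum by
  \<open>sqrt K * S\<close>, which is used for \<open>p - 2\<close> of the \<open>p\<close> powers in the integrand; the other two are
  integrated exactly.\<close>

lemma Lp_norm_trig_poly_le:
  assumes p: "2 \<le> p" and J: "finite J" and card: "real (card J) \<le> K"
    and S: "0 \<le> S" "(\<Sum>\<xi>\<in>J. (cmod (a \<xi>))\<^sup>2) \<le> S\<^sup>2"
  shows "Lp_norm p (trig_poly J a) \<le> ennreal (K powr (1 / 2 - 1 / p) * S)"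
proof -
  define P where "P = trig_poly J a"
  define B where "B = sqrt K * S"
  have "0 \<le> K"
    using card by linarith
  have "0 \<le> B"
    using \<open>0 \<le> K\<close> S by (simp add: B_def)
  have P_le: "cmod (P x) \<le> B" for x
  proof -
    have "cmod (P x) \<le> (\<Sum>\<xi>\<in>J. 1 * cmod (a \<xi>))"
      unfolding P_def trig_poly_def by (rule sum_norm_le) (simp add: norm_mult)
    then have "(cmod (P x))\<^sup>2 \<le> (\<Sum>\<xi>\<in>J. 1 * cmod (a \<xi>))\<^sup>2"
      by (rule power_mono) simp
    also have "\<dots> \<le> (\<Sum>\<xi>\<in>J. 1\<^sup>2) * (\<Sum>\<xi>\<in>J. (cmod (a \<xi>))\<^sup>2)"
      by (rule Cauchy_Schwarz_ineq_sum)
    also have "\<dots> \<le> K * S\<^sup>2"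
      using card S \<open>0 \<le> K\<close> by (intro mult_mono) (auto intro: sum_nonneg)
    also have "\<dots> = B\<^sup>2"
      using \<open>0 \<le> K\<close> by (simp add: B_def power_mult_distrib)
    finally show ?thesis
      using \<open>0 \<le> B\<close> by (rule power2_le_imp_le)
  qed
  have powr_le: "cmod (P x) powr p \<le> B powr (p - 2) * (cmod (P x))\<^sup>2" for x
  proof (cases "P x = 0")
    case False
    then have "cmod (P x) powr p = cmod (P x) powr (p - 2) * (cmod (P x))\<^sup>2"
      using powr_add[of "cmod (P x)" "p - 2" 2] by simp
    also have "\<dots> \<le> B powr (p - 2) * (cmod (P x))\<^sup>2"
      using p P_le[of x] by (intro mult_right_mono powr_mono2) auto
    finally show ?thesis .
  qed simp
  have int: "integrable torus_measure (\<lambda>x. B powr (p - 2) * (cmod (P x))\<^sup>2)"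
    unfolding P_def by (intro integrable_torus_measure continuous_intros continuous_on_trig_poly)
  have "(\<integral>\<^sup>+x. ennreal (cmod (P x) powr p) \<partial>torus_measure)
      \<le> (\<integral>\<^sup>+x. ennreal (B powr (p - 2) * (cmod (P x))\<^sup>2) \<partial>torus_measure)"
    by (intro nn_integral_mono ennreal_leI powr_le)
  also have "\<dots> = ennreal (\<integral>x. B powr (p - 2) * (cmod (P x))\<^sup>2 \<partial>torus_measure)"
    by (rule nn_integral_eq_integral[OF int]) simp
  also have "\<dots> = ennreal (B powr (p - 2) * (\<Sum>\<xi>\<in>J. (cmod (a \<xi>))\<^sup>2))"
    by (simp add: P_def parseval_trig_poly[OF J])
  also have "\<dots> \<le> ennreal (B powr (p - 2) * S\<^sup>2)"
    by (intro ennreal_leI mult_left_mono S) simp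
  also have "B powr (p - 2) * S\<^sup>2 = (K powr (1 / 2 - 1 / p) * S) powr p"
  proof (cases "S = 0")
    case False
    with S have "0 < S" by simp
    have "B powr (p - 2) * S\<^sup>2 = sqrt K powr (p - 2) * (S powr (p - 2) * S powr 2)"
      using \<open>0 < S\<close> \<open>0 \<le> K\<close> by (simp add: B_def powr_mult)
    also have "sqrt K powr (p - 2) = K powr (1 / 2 * (p - 2))"
      using \<open>0 \<le> K\<close> by (simp only: powr_half_sqrt[symmetric] powr_powr)
    also have "1 / 2 * (p - 2) = (1 / 2 - 1 / p) * p"
      using p by (simp add: left_diff_distrib diff_divide_distrib)
    also have "S powr (p - 2) * S powr 2 = S powr p"
      by (simp flip: powr_add)
    finally show ?thesis
      using \<open>0 < S\<close> \<open>0 \<le> K\<close> by (simp add: powr_mult powr_powr)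
  qed (use p in simp)
  finally have "Lp_norm p P \<le> ennreal_powr (ennreal ((K powr (1 / 2 - 1 / p) * S) powr p)) (1 / p)"
    unfolding Lp_norm_def using p by (intro ennreal_powr_mono) auto
  also have "\<dots> = ennreal (K powr (1 / 2 - 1 / p) * S)"
    using p S by (simp add: ennreal_powr_ennreal powr_powr)
  finally show ?thesis by (simp add: P_def)
qed

definition dyadic_freqs :: "nat \<Rightarrow> int set" where
  "dyadic_freqs m = {\<xi>. 2 ^ m \<le> \<bar>\<xi>\<bar> \<and> \<bar>\<xi>\<bar> < 2 ^ (m + 1)}"

lemma dyadic_block_eq_trig_poly: "dyadic_block m f = trig_poly (dyadic_freqs m) (fourier_coeff f)"
  by (simp add: fun_eq_iff dyadic_block_def trig_poly_def dyadic_freqs_def)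

lemma dyadic_freqs: "finite (dyadic_freqs m)" "real (card (dyadic_freqs m)) \<le> 2 * 2 ^ m"
proof -
  have sub: "dyadic_freqs m \<subseteq> {2 ^ m..<2 ^ (m + 1)} \<union> {- (2 ^ (m + 1))<..- (2 ^ m)}"
    by (auto simp: dyadic_freqs_def abs_if split: if_splits)
  then show "finite (dyadic_freqs m)"
    by (rule finite_subset) simp
  have "card (dyadic_freqs m) \<le> card ({2 ^ m..<2 ^ (m + 1)} \<union> {- (2 ^ (m + 1))<..- (2 ^ m :: int)})"
    by (rule card_mono[OF _ sub]) simp
  also have "\<dots> \<le> card {2 ^ m..<2 ^ (m + 1) :: int} + card {- (2 ^ (m + 1))<..- (2 ^ m :: int)}"
    by (rule card_Un_le)
  also have "\<dots> = 2 * 2 ^ m"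
    by (simp add: nat_power_eq)
  finally show "real (card (dyadic_freqs m)) \<le> 2 * 2 ^ m"
    using of_nat_mono by fastforce
qed

text \<open>The terms of the Besov sum are dominated by a geometric sequence of ratio \<open>2 powr ((r + d) * q)\<close>, which
  is below one since \<open>r + d < 0 < q\<close>.\<close>

lemma besov_norm_le_geometric:
  assumes q: "0 < q" and A: "0 \<le> A" and decay: "r + d < 0"
    and block: "\<And>m. Lp_norm p (dyadic_block m g) \<le> ennreal (A * 2 powr (real m * d))"
  shows "besov_norm r p q g \<le> ennreal (A * (1 / (1 - 2 powr ((r + d) * q))) powr (1 / q))"
proof -
  define \<theta> where "\<theta> = (2::real) powr ((r + d) * q)"
  have \<theta>: "0 < \<theta>" "\<theta> < 1"
    using mult_neg_pos[OF decay q] powr_less_mono[of "(r + d) * q" 0 "2::real"] by (simp_all add: \<theta>_def)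
  have "ennreal (2 powr (real m * r * q)) * ennreal_powr (Lp_norm p (dyadic_block m g)) q
      \<le> ennreal (A powr q * \<theta> ^ m)" for m
  proof -
    have "ennreal_powr (Lp_norm p (dyadic_block m g)) q
        \<le> ennreal_powr (ennreal (A * 2 powr (real m * d))) q"
      using q by (intro ennreal_powr_mono block) auto
    also have "\<dots> = ennreal (A powr q * 2 powr (real m * d * q))"
      using A by (simp add: ennreal_powr_ennreal powr_mult powr_powr)
    finally have "ennreal (2 powr (real m * r * q)) * ennreal_powr (Lp_norm p (dyadic_block m g)) q
        \<le> ennreal (2 powr (real m * r * q)) * ennreal (A powr q * 2 powr (real m * d * q))"
      by (rule mult_left_mono) simp
    also have "\<dots> = ennreal (A powr q * (2 powr (real m * r * q) * 2 powr (real m * d * q)))"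
      by (simp add: mult_ac flip: ennreal_mult')
    also have "2 powr (real m * r * q) * 2 powr (real m * d * q) = \<theta> ^ m"
      unfolding \<theta>_def by (simp add: powr_realpow[symmetric] powr_powr algebra_simps flip: powr_add)
    finally show ?thesis .
  qed
  then have "(\<Sum>m. ennreal (2 powr (real m * r * q)) * ennreal_powr (Lp_norm p (dyadic_block m g)) q)
      \<le> (\<Sum>m. ennreal (A powr q * \<theta> ^ m))"
    by (intro suminf_le) auto
  also have "\<dots> = ennreal (A powr q * (1 / (1 - \<theta>)))"
    by (rule suminf_ennreal_eq) (use \<theta> in \<open>auto intro: sums_mult[OF geometric_sums] simp del: times_divide_eq_right\<close>)
  finally have "besov_norm r p q g \<le> ennreal_powr (ennreal (A powr q * (1 / (1 - \<theta>)))) (1 / q)"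
    unfolding besov_norm_def using q by (intro ennreal_powr_mono) auto
  also have "\<dots> = ennreal (A * (1 / (1 - \<theta>)) powr (1 / q))"
    using q A \<theta> by (simp add: ennreal_powr_ennreal powr_mult powr_divide powr_powr)
  finally show ?thesis by (simp add: \<theta>_def)
qed

section \<open>Boundedness of the operator\<close>

text \<open>The assumed estimates leave out \<open>\<xi> = 0\<close>; there continuity and periodicity supply a bound, and the
  largest of the four constants serves for all frequencies.\<close>

lemma periodic_symbol_from_estimates:
  assumes C1: "\<And>\<xi>. (\<lambda>x. \<sigma> x \<xi>) \<in> Ck_torus 1" and order: "\<rho> \<in> {0..1}"
    and bound: "\<And>\<beta>. \<beta> \<le> 1 \<Longrightarrow>
      \<exists>C>0. \<forall>x \<xi>. \<xi> \<noteq> 0 \<longrightarrow>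
        cmod ((x_deriv ^^ \<beta>) (\<lambda>y. \<sigma> y \<xi>) x) \<le> C * \<bar>real_of_int \<xi>\<bar> powr (- \<rho>)"
  obtains C where "periodic_symbol \<sigma> (\<lambda>x \<xi>. x_deriv (\<lambda>y. \<sigma> y \<xi>) x) C \<rho>"
proof -
  obtain A0 where A0:
    "\<And>x \<xi>. \<xi> \<noteq> 0 \<Longrightarrow> cmod (\<sigma> x \<xi>) \<le> A0 * \<bar>real_of_int \<xi>\<bar> powr (- \<rho>)"
    using bound[of 0] by auto
  obtain A1 where A1:
    "\<And>x \<xi>. \<xi> \<noteq> 0 \<Longrightarrow> cmod (x_deriv (\<lambda>y. \<sigma> y \<xi>) x) \<le> A1 * \<bar>real_of_int \<xi>\<bar> powr (- \<rho>)"
    using bound[of 1] by auto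
  have cont: "continuous_on UNIV (\<lambda>x. \<sigma> x 0)"
    using Ck_torus_1D(2)[OF C1]
    by (meson continuous_at_imp_continuous_on has_vector_derivative_continuous)
  obtain B0 where B0: "\<And>x. cmod (\<sigma> x 0) \<le> B0"
    using periodic_bounded[OF Ck_torus_1D(1)[OF C1] cont] by blast
  obtain B1 where B1: "\<And>x. cmod (x_deriv (\<lambda>y. \<sigma> y 0) x) \<le> B1"
    using periodic_bounded[OF periodic_x_deriv[OF C1] Ck_torus_1D(3)[OF C1]] by blast
  define C where "C = max (max A0 A1) (max B0 B1)"
  have C: "A0 \<le> C" "A1 \<le> C" "B0 \<le> C" "B1 \<le> C"
    by (auto simp: C_def)
  have merge: "cmod z \<le> C * bracket \<xi> powr (- \<rho>)"
    if "\<xi> \<noteq> 0 \<Longrightarrow> cmod z \<le> A * \<bar>real_of_int \<xi>\<bar> powr (- \<rho>)" "A \<le> C"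
      "\<xi> = 0 \<Longrightarrow> cmod z \<le> B" "B \<le> C" for z \<xi> A B
  proof (cases "\<xi> = 0")
    case True
    with that(3,4) show ?thesis
      by (simp add: bracket_def)
  next
    case False
    then have "bracket \<xi> = \<bar>real_of_int \<xi>\<bar>"
      by (simp add: bracket_def)
    with order_trans[OF that(1)[OF False] mult_right_mono[OF that(2)]] show ?thesis
      by simp
  qed
  have "periodic_symbol \<sigma> (\<lambda>x \<xi>. x_deriv (\<lambda>y. \<sigma> y \<xi>) x) C \<rho>"
  proof
    show "\<sigma> (2 * pi) \<xi> = \<sigma> 0 \<xi>" for \<xi>
      using Ck_torus_1D(1)[OF C1, of 0 \<xi>] by simp
    show "cmod (\<sigma> x \<xi>) \<le> C * bracket \<xi> powr (- \<rho>)" for x \<xi>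
      by (rule merge[of \<xi> _ A0 B0]) (use A0 B0 C in auto)
    show "cmod (x_deriv (\<lambda>y. \<sigma> y \<xi>) x) \<le> C * bracket \<xi> powr (- \<rho>)" for x \<xi>
      by (rule merge[of \<xi> _ A1 B1]) (use A1 B1 C in auto)
  qed (use order Ck_torus_1D[OF C1] in auto)
  then show ?thesis by (rule that)
qed

text \<open>A block at level \<open>m\<close> has at most \<open>2 * 2 ^ m\<close> frequencies, all at least \<open>2 ^ m\<close> in modulus, so Bernstein's
  inequality costs \<open>2 powr (m * (1/2 - 1/p))\<close> and the decay of the coefficients gains
  \<open>2 powr (- m * \<rho>)\<close>. The constant is \<open>58 = 2 * 29\<close>, with \<open>29 \<ge> sqrt 800\<close>.\<close>

lemma (in periodic_symbol) Op_block_bound: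
  assumes f: "f \<in> Ck_torus 1" and H: "\<And>x. cmod (f x) \<le> H" and p: "2 \<le> p"
  shows "Lp_norm p (dyadic_block m (Op b f))
    \<le> ennreal (58 * C * H * 2 powr (real m * (1 / 2 - 1 / p - \<rho>)))"
proof -
  define e where "e = 1 / 2 - 1 / p"
  define N where "N = (2::real) ^ m"
  define S where "S = 29 * C * N powr (- \<rho>) * H"
  have "1 \<le> N" by (simp add: N_def)
  have "0 \<le> H"
    using order_trans[OF norm_ge_zero H] .
  have contf: "continuous_on UNIV f"
    using Ck_torus_1D(2)[OF f] by (meson continuous_at_imp_continuous_on has_vector_derivative_continuous)
  have l2: "(\<Sum>\<xi>\<in>F. (cmod (fourier_coeff f \<xi>))\<^sup>2) \<le> H\<^sup>2" if "finite F" for F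
  proof -
    have "(\<Sum>\<xi>\<in>F. (cmod (fourier_coeff f \<xi>))\<^sup>2) \<le> (\<integral>x. (cmod (f x))\<^sup>2 \<partial>torus_measure)"
      by (rule bessel_inequality[OF that contf])
    also have "\<dots> \<le> (\<integral>x. H\<^sup>2 \<partial>torus_measure)"
      by (intro integral_mono integrable_torus_measure continuous_intros contf power_mono H norm_ge_zero)
    finally show ?thesis by (simp add: torus.prob_space)
  qed
  have "(\<Sum>\<eta>\<in>dyadic_freqs m. (cmod (fourier_coeff (Op b f) \<eta>))\<^sup>2) \<le> 800 * (C * N powr (- \<rho>) * H)\<^sup>2"
  proof (rule Op_coeff_bound[OF summable_fourier_coeff[OF f] l2 dyadic_freqs(1) \<open>1 \<le> N\<close>])
    fix \<eta> assume "\<eta> \<in> dyadic_freqs m"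
    then have "2 ^ m \<le> \<bar>\<eta>\<bar>" by (simp add: dyadic_freqs_def)
    then have "real_of_int (2 ^ m) \<le> real_of_int \<bar>\<eta>\<bar>" by (simp only: of_int_le_iff)
    then show "N \<le> \<bar>of_int \<eta>\<bar>" by (simp add: N_def)
  qed
  also have "\<dots> \<le> S\<^sup>2"
    by (simp add: S_def power_mult_distrib mult_right_mono)
  finally have "Lp_norm p (dyadic_block m (Op b f)) \<le> ennreal ((2 * N) powr e * S)"
    unfolding dyadic_block_eq_trig_poly e_def using dyadic_freqs[of m] C_nonneg \<open>0 \<le> H\<close>
    by (intro Lp_norm_trig_poly_le[OF p]) (auto simp: S_def N_def)
  also have "\<dots> \<le> ennreal ((2 * N powr e) * S)"
  proof (intro ennreal_leI mult_right_mono)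
    have "0 \<le> 1 / p"
      using p by simp
    then have "2 powr e \<le> 2 powr (1::real)"
      by (intro powr_mono) (simp_all add: e_def del: zero_le_divide_1_iff)
    then show "(2 * N) powr e \<le> 2 * N powr e"
      by (simp add: powr_mult N_def mult_right_mono)
  qed (use C_nonneg \<open>0 \<le> H\<close> in \<open>simp add: S_def\<close>)
  also have "(2 * N powr e) * S = 58 * C * H * N powr (e - \<rho>)"
    by (simp add: S_def powr_diff powr_minus field_simps)
  also have "N powr (e - \<rho>) = 2 powr (real m * (e - \<rho>))"
    by (simp add: N_def powr_realpow[symmetric] powr_powr)
  finally show ?thesis by (simp add: e_def)
qed

theorem theorem3p6:
  fixes s p q r \<rho> :: real and \<sigma> :: "real \<Rightarrow> int \<Rightarrow> complex"
  assumes "0 < s" "s < 1"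
    and "2 \<le> p"
    and "0 < q"
    and "\<rho> \<in> {0..1}" "r + 1 - 2 / p < \<rho>"
    and "\<And>\<xi>. (\<lambda>x. \<sigma> x \<xi>) \<in> Ck_torus (nat \<lfloor>1 / p\<rfloor> + 1)"
    and "\<And>\<beta>. \<beta> \<le> nat \<lfloor>1 / p\<rfloor> + 1 \<Longrightarrow>
      \<exists>C>0. \<forall>x \<xi>. \<xi> \<noteq> 0 \<longrightarrow>
        cmod ((x_deriv ^^ \<beta>) (\<lambda>y. \<sigma> y \<xi>) x) \<le> C * \<bar>real_of_int \<xi>\<bar> powr (- \<rho>)"
  shows "bounded_into (Op \<sigma>) (holder_norm s) (besov_norm r p q)"
proof -
  have "\<lfloor>1 / p\<rfloor> = 0"
    using \<open>2 \<le> p\<close> by (intro floor_unique) auto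
  with assms(7,8) have C1: "\<And>\<xi>. (\<lambda>x. \<sigma> x \<xi>) \<in> Ck_torus 1"
    and bound: "\<And>\<beta>. \<beta> \<le> 1 \<Longrightarrow>
      \<exists>C>0. \<forall>x \<xi>. \<xi> \<noteq> 0 \<longrightarrow>
        cmod ((x_deriv ^^ \<beta>) (\<lambda>y. \<sigma> y \<xi>) x) \<le> C * \<bar>real_of_int \<xi>\<bar> powr (- \<rho>)"
    by simp_all
  obtain C where "periodic_symbol \<sigma> (\<lambda>x \<xi>. x_deriv (\<lambda>y. \<sigma> y \<xi>) x) C \<rho>"
    by (rule periodic_symbol_from_estimates[OF C1 \<open>\<rho> \<in> {0..1}\<close> bound])
  then interpret periodic_symbol \<sigma> "\<lambda>x \<xi>. x_deriv (\<lambda>y. \<sigma> y \<xi>) x" C \<rho> .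
  define d where "d = 1 / 2 - 1 / p - \<rho>"
  have "1 / p \<le> 1 / 2"
    using \<open>2 \<le> p\<close> by (intro divide_left_mono) auto
  \<comment> \<open>Being nonnegative, \<open>1 / 2 - 1 / p\<close> is at most its double \<open>1 - 2 / p\<close>.\<close>
  then have decay: "r + d < 0"
    using \<open>r + 1 - 2 / p < \<rho>\<close> by (simp add: d_def)
  define G where "G = (1 / (1 - 2 powr ((r + d) * q))) powr (1 / q)"
  \<comment> \<open>The summand \<open>1\<close> makes \<open>K\<close> positive also when \<open>C = 0\<close>.\<close>
  define K where "K = 58 * C * G + 1"
  have "0 \<le> G" "0 < K"
    using C_nonneg by (auto simp: G_def K_def intro: add_nonneg_pos)
  have "besov_norm r p q (Op \<sigma> f) \<le> ennreal K * holder_norm s f" if f: "f \<in> Cinf_torus" for f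
  proof (cases "holder_norm s f = \<infinity>")
    case True
    with \<open>0 < K\<close> show ?thesis by (simp add: ennreal_mult_top)
  next
    case False
    define H where "H = enn2real (holder_norm s f)"
    have H: "holder_norm s f = ennreal H" "0 \<le> H"
      using False by (simp_all add: H_def less_top)
    have f_le: "cmod (f x) \<le> H" for x
    proof -
      have "ennreal (cmod (f x)) \<le> (SUP x. ennreal (cmod (f x)))"
        by (rule SUP_upper) simp
      also have "\<dots> \<le> ennreal H"
        unfolding H(1)[symmetric] holder_norm_def by simp
      finally show ?thesis using H(2) by simp
    qed
    have f1: "f \<in> Ck_torus 1"
      using f by (simp add: Cinf_torus_def)
    have "besov_norm r p q (Op \<sigma> f) \<le> ennreal (58 * C * H * G)"
      unfolding G_def using C_nonneg H
      by (intro besov_norm_le_geometric \<open>0 < q\<close> decay Op_block_bound[OF f1 f_le \<open>2 \<le> p\<close>, folded d_def]) auto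
    also have "\<dots> \<le> ennreal (K * H)"
      using H(2) by (intro ennreal_leI) (simp add: K_def algebra_simps)
    also have "\<dots> = ennreal K * holder_norm s f"
      using \<open>0 < K\<close> H by (simp add: ennreal_mult')
    finally show ?thesis .
  qed
  with \<open>0 < K\<close> show ?thesis
    unfolding bounded_into_def by blast
qed

end
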